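(* Let $\alpha\in\mathbb R$ and set $M_\alpha=\sum_{k=1}^\infty\frac{k^{-\alpha}}{k+1}$. The inequality \[ \sup_{n\ge1}\Big|\sum_{k=n}^\infty\frac{x_k}k\Big|n^\alpha\le A\sup_{n\ge1}\Big|\frac1n\sum_{k=1}^nx_k\Big|n^\alpha \] holds for all $x\in\mathcal D(C^* )$ with \[ A=\begin{cases}\infty,&\alpha\le0;\\ 1+\dfrac1\alpha,&0<\alpha\le1;\\ 2^\alpha M_\alpha,&\alpha>1.\end{cases} \] It holds for all nonnegative $x\in\mathcal D(C^* )$ with \[ A=\begin{cases}\infty,&\alpha\le0;\\ \dfrac1\alpha,&0<\alpha\le1;\\ 0,&\alpha>1.\end{cases} \] In each case the constant $A$ is best possible (the least element of $[0,\infty]$ for which the inequality holds for all the indicated $x$).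
   Context: Sequences are indexed by the positive integers; suprema take values in $[0,\infty]$. $\mathcal D(C^* )$ is the set of all real sequences $x$ for which $\sum_{k=1}^\infty\frac{x_k}k$ converges (possibly conditionally) in $\mathbb R$. Conventions: $\infty\cdot0=0$ when $A=\infty$ and the supremum on the right is $0$; the inequality is regarded as holding whenever the supremum on the right-hand side is $\infty$ (even if $A=0$). *)

theory Defs
  imports Complex_Main "HOL-Library.Extended_Nonnegative_Real"
begin

text \<open>Sequences indexed by the positive integers are functions on \<^typ>\<open>nat\<close> whose value
  at \<open>0\<close> is never used.\<close>

definition cesaro :: "(nat \<Rightarrow> real) \<Rightarrow> nat \<Rightarrow> real" where
  "cesaro x n = (1 / real n) * (\<Sum>k = 1..n. x k)"

definition copson_dom :: "(nat \<Rightarrow> real) set" where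
  "copson_dom = {x. summable (\<lambda>k. x (Suc k) / real (Suc k))}"

text \<open>The tail \<open>\<Sum>\<^sub>k\<^sub>\<ge>\<^sub>n x\<^sub>k / k\<close>, as a limit of ordered partial sums.\<close>

definition copson :: "(nat \<Rightarrow> real) \<Rightarrow> nat \<Rightarrow> real" where
  "copson x n = (\<Sum>k. x (n + k) / real (n + k))"

definition weighted_sup :: "real \<Rightarrow> (nat \<Rightarrow> real) \<Rightarrow> ennreal" where
  "weighted_sup \<alpha> y = (SUP n\<in>{1..}. ennreal (\<bar>y n\<bar> * real n powr \<alpha>))"

text \<open>The first disjunct is the convention that the inequality holds whenever the supremum on
  the right is infinite; it matters only for \<open>A = 0\<close>, because \<open>0 * \<infinity> = 0\<close> in
  \<^typ>\<open>ennreal\<close>.\<close>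

definition copson_cesaro_ineq :: "real \<Rightarrow> ennreal \<Rightarrow> (nat \<Rightarrow> real) \<Rightarrow> bool" where
  "copson_cesaro_ineq \<alpha> A x \<longleftrightarrow>
     weighted_sup \<alpha> (cesaro x) = \<infinity> \<or>
     weighted_sup \<alpha> (copson x) \<le> A * weighted_sup \<alpha> (cesaro x)"

definition best_constant :: "real \<Rightarrow> (nat \<Rightarrow> real) set \<Rightarrow> ennreal \<Rightarrow> bool" where
  "best_constant \<alpha> X A \<longleftrightarrow>
     (\<forall>x\<in>X. copson_cesaro_ineq \<alpha> A x) \<and>
     (\<forall>B. (\<forall>x\<in>X. copson_cesaro_ineq \<alpha> B x) \<longrightarrow> A \<le> B)"

text \<open>The series runs over \<open>k \<ge> 1\<close>. It is summed in \<open>[0,\<infinity>]\<close> since it diverges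
  for \<open>\<alpha> \<le> 0\<close>.\<close>

definition M :: "real \<Rightarrow> ennreal" where
  "M \<alpha> = (\<Sum>k. ennreal (real (Suc k) powr (- \<alpha>) / (real (Suc k) + 1)))"

end

theory Submission
  imports Defs "HOL-Analysis.Analysis"
begin

text \<open>Write \<open>C k\<close> for the means \<open>cesaro x k\<close>. If \<open>\<alpha> > 0\<close> and the right-hand supremum is
  finite, then \<open>C k\<close> tends to \<open>0\<close>, and Abel summation (\<open>copson_sums\<close>) turns the Copson tail
  into a linear expression in the means,

  \<open>copson x n = (\<Sum>k\<ge>n. C k / (k + 1)) - (n - 1) / n * C (n - 1)\<close>.

  The means may be prescribed freely, so under the constraint \<open>\<bar>C k\<bar> \<le> k powr (- \<alpha>)\<close> the
  modulus of this expression is largest when \<open>C k = k powr (- \<alpha>)\<close> for \<open>k \<ge> n\<close> and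
  \<open>C k = - (k powr (- \<alpha>))\<close> for \<open>k < n\<close>. Hence the best constant on the whole domain is the
  supremum over \<open>n\<close> of

  \<open>n powr \<alpha> * (\<Sum>k\<ge>n. k powr (- \<alpha>) / (k + 1)) + (n / (n - 1)) powr (\<alpha> - 1)\<close>,

  where the second summand is absent for \<open>n = 1\<close>. What remains is to compute this supremum,
  by comparing \<open>k powr (- \<alpha>) / (k + 1)\<close> with the telescoping difference
  \<open>k powr (- \<alpha>) - (k + 1) powr (- \<alpha>)\<close>. For \<open>\<alpha> \<le> 1\<close>, Bernoulli's inequality bounds the two
  summands by \<open>1 / \<alpha>\<close> and \<open>1\<close>, and both bounds are approached as \<open>n\<close> grows
  (\<open>extremal_value_bounds\<close>). For \<open>\<alpha> > 1\<close>, convexity of the power makes the quotient of the two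
  sequences monotone; both summands then decrease from \<open>n = 2\<close> on, and the value at \<open>2\<close> is
  \<open>2 powr \<alpha> * M \<alpha>\<close> (\<open>extremal_value_1\<close>, \<open>extremal_value_le_1\<close>), larger than the value \<open>M \<alpha>\<close> at \<open>1\<close>.

  For nonnegative \<open>x\<close> the subtracted mean only helps, which leaves the first summand and
  the constant \<open>1 / \<alpha>\<close> when \<open>\<alpha> \<le> 1\<close>; the extremal means are \<open>0\<close> before \<open>n\<close> and
  \<open>k powr (- \<alpha>)\<close> from \<open>n\<close> on. When \<open>\<alpha> > 1\<close>, a finite right-hand side forces \<open>x = 0\<close>
  (\<open>nonneg_eq_zero_of_cesaro_decay\<close>). When \<open>\<alpha> \<le> 0\<close>, indicators of initial segments and the
  divergence of the harmonic series rule out every finite constant (\<open>no_finite_constant\<close>).\<close>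

section \<open>Two consequences of convexity of powers\<close>

text \<open>Bernoulli's inequality for exponents in \<open>(0, 1]\<close>: weighted AM-GM for \<open>y\<close> and \<open>1\<close>.\<close>

lemma powr_le_one_plus_mult:
  fixes y \<alpha> :: real
  assumes "0 < \<alpha>" "\<alpha> \<le> 1" "0 < y"
  shows "y powr \<alpha> \<le> 1 + \<alpha> * (y - 1)"
  using Youngs_inequality_0[of \<alpha> "1 - \<alpha>" y 1] assms by (simp add: algebra_simps)

text \<open>The chord of the convex function \<open>u powr \<alpha>\<close> between \<open>u\<close> and \<open>1\<close> gets steeper as \<open>u\<close>
  grows; here \<open>u = 1 - t\<close> and \<open>u = 1 - s\<close>, and the slopes are cross-multiplied.\<close>

lemma chord_slope_antimono:
  fixes s t \<alpha> :: real
  assumes "1 \<le> \<alpha>" "0 < s" "s \<le> t" "t < 1"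
  shows "s * (1 - (1 - t) powr \<alpha>) \<le> t * (1 - (1 - s) powr \<alpha>)"
proof -
  have "((1 - s / t) *\<^sub>R 1 + (s / t) *\<^sub>R (1 - t)) powr \<alpha>
      \<le> (1 - s / t) * 1 powr \<alpha> + (s / t) * (1 - t) powr \<alpha>"
    using assms by (intro convex_onD[OF powr_convex]) auto
  moreover have "(1 - s / t) *\<^sub>R 1 + (s / t) *\<^sub>R (1 - t) = 1 - s"
    using assms by (simp add: field_simps)
  ultimately have "(1 - s) powr \<alpha> \<le> (1 - s / t) * 1 powr \<alpha> + (s / t) * (1 - t) powr \<alpha>"
    by (simp only:)
  then have "t * (1 - s) powr \<alpha> \<le> t * ((1 - s / t) * 1 powr \<alpha> + (s / t) * (1 - t) powr \<alpha>)"
    using assms by (intro mult_left_mono) auto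
  also have "\<dots> = t - s + s * (1 - t) powr \<alpha>"
    using assms by (simp add: field_simps)
  finally show ?thesis by (simp add: algebra_simps)
qed

section \<open>Tails of the series for the constant\<close>

definition tail_term :: "real \<Rightarrow> nat \<Rightarrow> real" where
  "tail_term \<alpha> k = real k powr (- \<alpha>) / (real k + 1)"

definition power_tail :: "real \<Rightarrow> nat \<Rightarrow> real" where
  "power_tail \<alpha> n = (\<Sum>j. tail_term \<alpha> (n + j))"

lemma tail_term_nonneg: "0 \<le> tail_term \<alpha> k"
  by (simp add: tail_term_def)

lemma summable_tail_term:
  assumes "0 < \<alpha>"
  shows "summable (\<lambda>j. tail_term \<alpha> (n + j))"
proof -
  have "summable (\<lambda>k. tail_term \<alpha> k)"
  proof (rule summable_comparison_test')
    show "summable (\<lambda>k. real k powr (- \<alpha> - 1))"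
      using assms by (simp add: summable_real_powr_iff)
    show "norm (tail_term \<alpha> k) \<le> real k powr (- \<alpha> - 1)" if "1 \<le> k" for k
    proof -
      have "tail_term \<alpha> k \<le> real k powr (- \<alpha>) / real k"
        unfolding tail_term_def using that by (intro divide_left_mono) auto
      also have "\<dots> = real k powr (- \<alpha> - 1)"
        using that by (simp add: powr_diff)
      finally show ?thesis by (simp add: tail_term_nonneg)
    qed
  qed
  then have "summable (\<lambda>j. tail_term \<alpha> (j + n))"
    by (simp add: summable_iff_shift)
  then show ?thesis by (simp add: add.commute)
qed

lemma power_tail_nonneg:
  assumes "0 < \<alpha>" shows "0 \<le> power_tail \<alpha> n"
  unfolding power_tail_def by (intro suminf_nonneg summable_tail_term assms tail_term_nonneg)

lemma power_tail_Suc: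
  assumes "0 < \<alpha>"
  shows "power_tail \<alpha> (Suc n) = power_tail \<alpha> n - tail_term \<alpha> n"
  using suminf_split_head[OF summable_tail_term[OF assms, of n]] by (simp add: power_tail_def)

text \<open>The telescoping differences of \<open>k powr (- \<alpha>)\<close>, with total \<open>n powr (- \<alpha>)\<close> from \<open>n\<close> on.
  They are the yardstick for \<^const>\<open>tail_term\<close>: the quotient of the two tends to \<open>1 / \<alpha>\<close>, so
  comparing them term by term gives sharp information on \<^const>\<open>power_tail\<close>.\<close>

definition powr_drop :: "real \<Rightarrow> nat \<Rightarrow> real" where
  "powr_drop \<alpha> k = real k powr (- \<alpha>) - real (Suc k) powr (- \<alpha>)"

lemma powr_drop_sums:
  assumes "0 < \<alpha>"
  shows "(\<lambda>j. powr_drop \<alpha> (n + j)) sums (real n powr (- \<alpha>))"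
proof -
  have "(\<lambda>j. real (n + j) powr (- \<alpha>)) \<longlonglongrightarrow> 0"
    by (rule tendsto_neg_powr) (use assms in \<open>auto intro!: filterlim_compose[OF filterlim_real_sequentially]
        filterlim_add_const_nat_at_top simp: add.commute[of n] simp del: of_nat_add\<close>)
  from telescope_sums'[OF this] show ?thesis by (simp add: powr_drop_def)
qed

text \<open>With \<open>t = 1 / (k + 1)\<close> the quotient of \<^const>\<open>powr_drop\<close> by \<^const>\<open>tail_term\<close> is the chord slope
  \<open>(1 - (1 - t) powr \<alpha>) / t\<close>.\<close>

lemma powr_drop_eq:
  assumes "1 \<le> k"
  shows "powr_drop \<alpha> k = real k powr (- \<alpha>) * (1 - (1 - 1 / (real k + 1)) powr \<alpha>)"
proof -
  have "1 - 1 / (real k + 1) = real k / (real k + 1)" by (simp add: field_simps)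
  then show ?thesis
    using assms by (simp add: powr_drop_def powr_divide powr_minus field_simps)
qed

text \<open>Bernoulli's inequality at \<open>k / (k + 1)\<close>; at \<open>\<alpha> = 1\<close> both sides are \<open>1 / (k (k + 1))\<close>.\<close>

lemma tail_term_le_drop:
  assumes "0 < \<alpha>" "\<alpha> \<le> 1" "1 \<le> k"
  shows "\<alpha> * tail_term \<alpha> k \<le> powr_drop \<alpha> k"
proof -
  have "\<alpha> / (real k + 1) \<le> 1 - (1 - 1 / (real k + 1)) powr \<alpha>"
    using powr_le_one_plus_mult[of \<alpha> "1 - 1 / (real k + 1)"] assms by simp
  then have "real k powr (- \<alpha>) * (\<alpha> / (real k + 1)) \<le> powr_drop \<alpha> k"
    unfolding powr_drop_eq[OF assms(3)] by (rule mult_left_mono) simp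
  then show ?thesis by (simp add: tail_term_def mult_ac)
qed

text \<open>Bernoulli's inequality at \<open>(k + 1) / k\<close>. The loss \<open>1 + 1 / k\<close> disappears as \<open>k\<close> grows,
  so together with the previous bound this determines the tails asymptotically.\<close>

lemma drop_le_tail_term:
  assumes "0 < \<alpha>" "\<alpha> \<le> 1" "1 \<le> k"
  shows "powr_drop \<alpha> k \<le> (1 + 1 / real k) * (\<alpha> * tail_term \<alpha> k)"
proof -
  have "real (Suc k) powr \<alpha> = real k powr \<alpha> * (1 + 1 / real k) powr \<alpha>"
    using assms by (simp flip: powr_mult add: algebra_simps)
  then have "powr_drop \<alpha> k = real (Suc k) powr (- \<alpha>) * ((1 + 1 / real k) powr \<alpha> - 1)"
    using assms by (simp add: powr_drop_def powr_minus field_simps)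
  also have "\<dots> \<le> real k powr (- \<alpha>) * (\<alpha> / real k)"
  proof (intro mult_mono powr_mono2')
    show "(1 + 1 / real k) powr \<alpha> - 1 \<le> \<alpha> / real k"
      using powr_le_one_plus_mult[of \<alpha> "1 + 1 / real k"] assms by (simp add: add_pos_nonneg)
  qed (use assms in \<open>auto simp: ge_one_powr_ge_zero\<close>)
  also have "\<dots> = (1 + 1 / real k) * (\<alpha> * tail_term \<alpha> k)"
    using assms by (simp add: tail_term_def divide_simps add_pos_nonneg)
  finally show ?thesis .
qed

lemma power_tail_le:
  assumes "0 < \<alpha>" "\<alpha> \<le> 1" "1 \<le> n"
  shows "\<alpha> * power_tail \<alpha> n \<le> real n powr (- \<alpha>)"
proof -
  have "(\<Sum>j. \<alpha> * tail_term \<alpha> (n + j)) \<le> (\<Sum>j. powr_drop \<alpha> (n + j))"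
    using assms powr_drop_sums[OF assms(1), of n]
    by (intro suminf_le tail_term_le_drop summable_mult summable_tail_term) (auto simp: sums_iff)
  then show ?thesis
    using powr_drop_sums[OF assms(1), of n] summable_tail_term[OF assms(1)]
    by (simp add: sums_iff suminf_mult power_tail_def)
qed

lemma power_tail_ge:
  assumes "0 < \<alpha>" "\<alpha> \<le> 1" "1 \<le> n"
  shows "real n powr (- \<alpha>) \<le> (1 + 1 / real n) * (\<alpha> * power_tail \<alpha> n)"
proof -
  have le: "powr_drop \<alpha> (n + j) \<le> (1 + 1 / real n) * (\<alpha> * tail_term \<alpha> (n + j))" for j
  proof -
    have "powr_drop \<alpha> (n + j) \<le> (1 + 1 / real (n + j)) * (\<alpha> * tail_term \<alpha> (n + j))"
      using assms by (intro drop_le_tail_term) auto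
    also have "\<dots> \<le> (1 + 1 / real n) * (\<alpha> * tail_term \<alpha> (n + j))"
      using assms by (intro mult_right_mono add_left_mono divide_left_mono)
        (auto simp: tail_term_nonneg)
    finally show ?thesis .
  qed
  have "(\<Sum>j. powr_drop \<alpha> (n + j)) \<le> (\<Sum>j. (1 + 1 / real n) * (\<alpha> * tail_term \<alpha> (n + j)))"
    using assms powr_drop_sums[OF assms(1), of n]
    by (intro suminf_le le summable_mult summable_tail_term) (auto simp: sums_iff)
  then show ?thesis
    using powr_drop_sums[OF assms(1), of n] summable_tail_term[OF assms(1)]
    by (simp add: sums_iff suminf_mult power_tail_def summable_mult)
qed

text \<open>For exponents up to \<open>1\<close> the scaled tails stay below \<open>1 / \<alpha>\<close> and converge to it, so
  \<open>1 / \<alpha>\<close> is their supremum.\<close>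

lemma scaled_power_tail_bounds:
  assumes "0 < \<alpha>" "\<alpha> \<le> 1" "1 \<le> n"
  shows "real n / real (Suc n) * (1 / \<alpha>) \<le> real n powr \<alpha> * power_tail \<alpha> n"
    and "real n powr \<alpha> * power_tail \<alpha> n \<le> 1 / \<alpha>"
proof -
  have inv: "real n powr (- \<alpha>) = 1 / real n powr \<alpha>" by (simp add: powr_minus divide_simps)
  have "real n powr \<alpha> > 0" using assms by simp
  then show "real n powr \<alpha> * power_tail \<alpha> n \<le> 1 / \<alpha>"
    using power_tail_le[OF assms] assms unfolding inv by (simp add: field_simps)
  show "real n / real (Suc n) * (1 / \<alpha>) \<le> real n powr \<alpha> * power_tail \<alpha> n"
  proof -
    have "1 / real n powr \<alpha> \<le> real (Suc n) / real n * (\<alpha> * power_tail \<alpha> n)"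
      using power_tail_ge[OF assms] assms unfolding inv by (simp add: field_simps)
    then have "real n / real (Suc n) * (1 / \<alpha>) * real n powr \<alpha> * (1 / real n powr \<alpha>)
        \<le> real n / real (Suc n) * (1 / \<alpha>) * real n powr \<alpha> * (real (Suc n) / real n * (\<alpha> * power_tail \<alpha> n))"
      using assms by (intro mult_left_mono) auto
    then show ?thesis using assms by simp
  qed
qed

text \<open>The quotients \<open>powr_drop \<alpha> k / tail_term \<alpha> k\<close> are the chord slopes at \<open>t = 1 / (k + 1)\<close>, which
  shrinks as \<open>k\<close> grows. Cross-multiplication keeps the form that can be summed over \<open>k\<close>.\<close>

lemma tail_term_drop_cross_le:
  assumes "1 \<le> \<alpha>" "1 \<le> n" "n \<le> k"
  shows "powr_drop \<alpha> n * tail_term \<alpha> k \<le> tail_term \<alpha> n * powr_drop \<alpha> k"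
proof -
  let ?s = "1 / (real k + 1)" and ?t = "1 / (real n + 1)"
  have "?s * (1 - (1 - ?t) powr \<alpha>) \<le> ?t * (1 - (1 - ?s) powr \<alpha>)"
    using assms by (intro chord_slope_antimono) (auto simp: field_simps)
  then have "(real n powr (- \<alpha>) * real k powr (- \<alpha>)) * (?s * (1 - (1 - ?t) powr \<alpha>))
      \<le> (real n powr (- \<alpha>) * real k powr (- \<alpha>)) * (?t * (1 - (1 - ?s) powr \<alpha>))"
    by (rule mult_left_mono) simp
  then show ?thesis
    using assms by (simp add: powr_drop_eq tail_term_def mult_ac)
qed

text \<open>The scaled tail is a weighted mean of the quotients \<open>tail_term \<alpha> k / powr_drop \<alpha> k\<close> over
  \<open>k \<ge> n\<close>, with weights \<open>n powr \<alpha> * powr_drop \<alpha> k\<close> of total \<open>1\<close>. These quotients decrease,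
  so the first one is at least the mean, and dropping it cannot raise the mean.\<close>

lemma scaled_power_tail_antimono:
  assumes "1 \<le> \<alpha>" "1 \<le> n"
  shows "real (Suc n) powr \<alpha> * power_tail \<alpha> (Suc n) \<le> real n powr \<alpha> * power_tail \<alpha> n"
proof -
  have a0: "0 < \<alpha>" using assms by simp
  have "(\<Sum>j. powr_drop \<alpha> n * tail_term \<alpha> (n + j)) \<le> (\<Sum>j. tail_term \<alpha> n * powr_drop \<alpha> (n + j))"
    using assms powr_drop_sums[OF a0, of n] a0
    by (intro suminf_le tail_term_drop_cross_le summable_mult summable_tail_term)
      (auto simp: sums_iff)
  then have *: "powr_drop \<alpha> n * power_tail \<alpha> n \<le> tail_term \<alpha> n * real n powr (- \<alpha>)"
    using powr_drop_sums[OF a0, of n] summable_tail_term[OF a0]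
    by (simp add: sums_iff suminf_mult power_tail_def)
  \<comment> \<open>The claim, multiplied by \<open>n powr (- \<alpha>) * (n + 1) powr (- \<alpha>)\<close>, is linear in the tail; the
    coefficient of the tail is the drop.\<close>
  have "real n powr (- \<alpha>) * (power_tail \<alpha> n - tail_term \<alpha> n)
      \<le> real (Suc n) powr (- \<alpha>) * power_tail \<alpha> n"
    using * by (simp add: powr_drop_def algebra_simps)
  then have "(real n powr \<alpha> * real (Suc n) powr \<alpha>) * (real n powr (- \<alpha>) * power_tail \<alpha> (Suc n))
      \<le> (real n powr \<alpha> * real (Suc n) powr \<alpha>) * (real (Suc n) powr (- \<alpha>) * power_tail \<alpha> n)"
    unfolding power_tail_Suc[OF a0] by (rule mult_left_mono) simp
  then show ?thesis
    using assms by (simp add: powr_minus field_simps)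
qed

section \<open>The extremal values\<close>

text \<open>For \<open>\<alpha> > 0\<close>, the largest value of \<open>\<bar>copson x (Suc m)\<bar> * real (Suc m) powr \<alpha>\<close> under the constraint
  \<open>\<bar>cesaro x k\<bar> \<le> k powr (- \<alpha>)\<close> for all \<open>k \<ge> 1\<close>. The position is written \<open>Suc m\<close> because the
  mean that precedes it enters the formula; for \<open>m = 0\<close> that contribution is \<open>0\<close>.\<close>

definition extremal_value :: "real \<Rightarrow> nat \<Rightarrow> real" where
  "extremal_value \<alpha> m =
     real (Suc m) powr \<alpha> * (power_tail \<alpha> (Suc m) + real m / real (Suc m) * real m powr (- \<alpha>))"

lemma extremal_value_eq:
  "extremal_value \<alpha> m = real (Suc m) powr \<alpha> * power_tail \<alpha> (Suc m)
     + (real (Suc m) / real m) powr \<alpha> * (real m / real (Suc m))"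
  by (simp add: extremal_value_def powr_divide powr_minus field_simps)

lemma extremal_value_bounds:
  assumes "0 < \<alpha>" "\<alpha> \<le> 1"
  shows "real m / real (Suc m) * (1 + 1 / \<alpha>) \<le> extremal_value \<alpha> m"
    and "extremal_value \<alpha> m \<le> 1 + 1 / \<alpha>"
proof -
  note tail = scaled_power_tail_bounds[OF assms, of "Suc m"]
  let ?r = "real (Suc m) / real m"
  have "real m / real (Suc m) * (1 / \<alpha>) \<le> real (Suc m) / real (Suc (Suc m)) * (1 / \<alpha>)"
    using assms by (intro mult_right_mono) (auto simp: field_simps)
  moreover have "real m / real (Suc m) \<le> ?r powr \<alpha> * (real m / real (Suc m))"
  proof (cases "m = 0")
    case False
    then have "1 \<le> ?r powr \<alpha>" using assms by (intro ge_one_powr_ge_zero) auto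
    then show ?thesis using mult_right_mono[of 1 "?r powr \<alpha>" "real m / real (Suc m)"] by simp
  qed simp
  ultimately show "real m / real (Suc m) * (1 + 1 / \<alpha>) \<le> extremal_value \<alpha> m"
    unfolding extremal_value_eq using tail(1) by (simp only: distrib_left) simp
  have "?r powr \<alpha> * (real m / real (Suc m)) \<le> 1"
  proof (cases "m = 0")
    case False
    then have "?r powr \<alpha> \<le> ?r powr 1" using assms by (intro powr_mono) auto
    then have "?r powr \<alpha> * (real m / real (Suc m)) \<le> ?r * (real m / real (Suc m))"
      by (intro mult_right_mono) auto
    then show ?thesis using False by simp
  qed simp
  then show "extremal_value \<alpha> m \<le> 1 + 1 / \<alpha>"
    unfolding extremal_value_eq using tail(2) by (simp only: add.commute[of 1] add_mono)
qed

text \<open>Position \<open>2\<close>: the contribution \<open>1 / 2\<close> of the preceding mean is exactly the first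
  term of the tail that starts at \<open>1\<close>, which is how \<open>M \<alpha>\<close> enters the theorem.\<close>

lemma extremal_value_1:
  assumes "0 < \<alpha>"
  shows "extremal_value \<alpha> 1 = 2 powr \<alpha> * power_tail \<alpha> 1"
  using power_tail_Suc[OF assms, of 1] by (simp add: extremal_value_def tail_term_def)

text \<open>Both summands of \<open>extremal_value_eq\<close> decrease in \<open>m \<ge> 1\<close>: the scaled tail by
  \<open>scaled_power_tail_antimono\<close>, the other one because it is a positive power of \<open>1 + 1 / m\<close>.\<close>

lemma extremal_value_le_1:
  assumes "1 < \<alpha>"
  shows "extremal_value \<alpha> m \<le> extremal_value \<alpha> 1"
proof (cases "m = 0")
  case True
  have "1 * power_tail \<alpha> 1 \<le> 2 powr \<alpha> * power_tail \<alpha> 1"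
    using assms by (intro mult_right_mono ge_one_powr_ge_zero power_tail_nonneg) auto
  then show ?thesis
    using assms True extremal_value_1[of \<alpha>] by (simp add: extremal_value_def)
next
  case False
  then have "1 \<le> m" by simp
  have "real (Suc m) powr \<alpha> * power_tail \<alpha> (Suc m) \<le> real (Suc 1) powr \<alpha> * power_tail \<alpha> (Suc 1)"
    using \<open>1 \<le> m\<close>
  proof (induction m rule: dec_induct)
    case (step n)
    then show ?case using scaled_power_tail_antimono[of \<alpha> "Suc n"] assms by simp
  qed simp
  moreover have "(real (Suc m) / real m) powr \<alpha> * (real m / real (Suc m))
      = (real (Suc m) / real m) powr (\<alpha> - 1)"
    using False by (simp add: powr_diff field_simps)
  moreover have "(real (Suc m) / real m) powr (\<alpha> - 1) \<le> 2 powr (\<alpha> - 1)"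
    using assms \<open>1 \<le> m\<close> by (intro powr_mono2) (auto simp: field_simps)
  moreover have "extremal_value \<alpha> 1 = real (Suc 1) powr \<alpha> * power_tail \<alpha> (Suc 1) + 2 powr (\<alpha> - 1)"
    by (simp add: extremal_value_eq powr_diff)
  ultimately show ?thesis by (simp add: extremal_value_eq)
qed

lemma M_eq_power_tail:
  assumes "0 < \<alpha>"
  shows "M \<alpha> = ennreal (power_tail \<alpha> 1)"
  using suminf_ennreal2[OF tail_term_nonneg summable_tail_term[OF assms, of 1]]
  by (simp add: M_def power_tail_def tail_term_def)

section \<open>Abel summation: the Copson tail in terms of the means\<close>

lemma cesaro_mult: "real n * cesaro x n = (\<Sum>k = 1..n. x k)"
  by (cases "n = 0") (auto simp: cesaro_def)

text \<open>Summation by parts, using \<open>x k = k * cesaro x k - (k - 1) * cesaro x (k - 1)\<close>.\<close>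

lemma copson_partial_sum:
  "(\<Sum>j<k. x (Suc m + j) / real (Suc m + j)) =
     (\<Sum>j<k. cesaro x (Suc m + j) / (real (Suc m + j) + 1))
     - real m / real (Suc m) * cesaro x m
     + real (m + k) / real (Suc (m + k)) * cesaro x (m + k)"
proof (induction k)
  case (Suc k)
  let ?n = "Suc (m + k)"
  have "x ?n = real ?n * cesaro x ?n - real (m + k) * cesaro x (m + k)"
    unfolding cesaro_mult by simp
  then have "x ?n / real ?n = cesaro x ?n - real (m + k) / real ?n * cesaro x (m + k)"
    by (simp add: field_simps)
  moreover have "cesaro x ?n
      = cesaro x ?n / (real ?n + 1) + real ?n / real (Suc ?n) * cesaro x ?n"
    by (simp add: divide_simps) (simp add: algebra_simps)
  ultimately show ?case using Suc.IH by simp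
qed simp

lemma copson_sums:
  assumes "cesaro x \<longlonglongrightarrow> 0"
    and "summable (\<lambda>j. cesaro x (Suc m + j) / (real (Suc m + j) + 1))"
  shows "(\<lambda>j. x (Suc m + j) / real (Suc m + j)) sums
    ((\<Sum>j. cesaro x (Suc m + j) / (real (Suc m + j) + 1)) - real m / real (Suc m) * cesaro x m)"
proof -
  have "(\<lambda>n. real n / real (Suc n) * cesaro x n) \<longlonglongrightarrow> 1 * 0"
    by (intro tendsto_mult LIMSEQ_n_over_Suc_n assms(1))
  then have "(\<lambda>n. real n / real (Suc n) * cesaro x n) \<longlonglongrightarrow> 0"
    by simp
  then have "(\<lambda>k. real (k + m) / real (Suc (k + m)) * cesaro x (k + m)) \<longlonglongrightarrow> 0"
    by (rule LIMSEQ_ignore_initial_segment)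
  then have "(\<lambda>k. real (m + k) / real (Suc (m + k)) * cesaro x (m + k)) \<longlonglongrightarrow> 0"
    by (simp only: add.commute)
  from tendsto_add[OF tendsto_diff[OF summable_LIMSEQ[OF assms(2)] tendsto_const] this]
  show ?thesis unfolding sums_def copson_partial_sum by simp
qed

text \<open>A power bound on the means makes them tend to \<open>0\<close> and their series converge absolutely,
  which is all that Abel's formula requires; for \<open>m = 0\<close> this says that \<open>x\<close> lies in the domain.\<close>

lemma copson_of_cesaro_bound:
  assumes "0 < \<alpha>" and bound: "\<And>k. 1 \<le> k \<Longrightarrow> \<bar>cesaro x k\<bar> \<le> K * real k powr (- \<alpha>)"
  shows "(\<lambda>j. x (Suc m + j) / real (Suc m + j)) sums
      ((\<Sum>j. cesaro x (Suc m + j) / (real (Suc m + j) + 1)) - real m / real (Suc m) * cesaro x m)"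
    and "\<bar>\<Sum>j. cesaro x (Suc m + j) / (real (Suc m + j) + 1)\<bar> \<le> K * power_tail \<alpha> (Suc m)"
proof -
  have "(\<lambda>k. K * real k powr (- \<alpha>)) \<longlonglongrightarrow> K * 0"
    using assms by (intro tendsto_mult tendsto_const tendsto_neg_powr filterlim_real_sequentially) auto
  then have "cesaro x \<longlonglongrightarrow> 0"
    using bound by (intro Lim_null_comparison[of "cesaro x" "\<lambda>k. K * real k powr (- \<alpha>)"])
      (auto simp: eventually_sequentially intro!: exI[of _ 1])
  have le: "\<bar>cesaro x (Suc m + j) / (real (Suc m + j) + 1)\<bar> \<le> K * tail_term \<alpha> (Suc m + j)" for j
    using divide_right_mono[OF bound[of "Suc m + j"], of "real (Suc m + j) + 1"]
    by (simp add: tail_term_def abs_divide)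
  have sK: "summable (\<lambda>j. K * tail_term \<alpha> (Suc m + j))"
    by (intro summable_mult summable_tail_term assms)
  then have abs: "summable (\<lambda>j. \<bar>cesaro x (Suc m + j) / (real (Suc m + j) + 1)\<bar>)"
    by (rule summable_comparison_test') (use le in simp)
  show "(\<lambda>j. x (Suc m + j) / real (Suc m + j)) sums
      ((\<Sum>j. cesaro x (Suc m + j) / (real (Suc m + j) + 1)) - real m / real (Suc m) * cesaro x m)"
    by (intro copson_sums \<open>cesaro x \<longlonglongrightarrow> 0\<close> summable_rabs_cancel[OF abs])
  have "\<bar>\<Sum>j. cesaro x (Suc m + j) / (real (Suc m + j) + 1)\<bar>
      \<le> (\<Sum>j. \<bar>cesaro x (Suc m + j) / (real (Suc m + j) + 1)\<bar>)"
    by (rule summable_rabs[OF abs])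
  also have "\<dots> \<le> (\<Sum>j. K * tail_term \<alpha> (Suc m + j))"
    by (intro suminf_le le abs sK)
  also have "\<dots> = K * power_tail \<alpha> (Suc m)"
    unfolding power_tail_def by (rule suminf_mult[OF summable_tail_term[OF assms(1)]])
  finally show "\<bar>\<Sum>j. cesaro x (Suc m + j) / (real (Suc m + j) + 1)\<bar> \<le> K * power_tail \<alpha> (Suc m)" .
qed

text \<open>The triangle inequality in Abel's formula, whose two terms may add up when \<open>x\<close> changes sign.\<close>

lemma copson_abs_le:
  assumes "0 < \<alpha>" and bound: "\<And>k. 1 \<le> k \<Longrightarrow> \<bar>cesaro x k\<bar> \<le> K * real k powr (- \<alpha>)"
  shows "\<bar>copson x (Suc m)\<bar> * real (Suc m) powr \<alpha> \<le> K * extremal_value \<alpha> m"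
proof -
  have copson_eq: "copson x (Suc m) =
      (\<Sum>j. cesaro x (Suc m + j) / (real (Suc m + j) + 1)) - real m / real (Suc m) * cesaro x m"
    unfolding copson_def using copson_of_cesaro_bound(1)[of \<alpha> x K m, OF assms]
    by (intro sums_unique[symmetric])
  have "\<bar>real m / real (Suc m) * cesaro x m\<bar> \<le> real m / real (Suc m) * (K * real m powr (- \<alpha>))"
  proof (cases "m = 0")
    case False
    then show ?thesis using bound[of m] by (simp add: abs_mult divide_right_mono mult_left_mono)
  qed simp
  then have "\<bar>copson x (Suc m)\<bar>
      \<le> K * power_tail \<alpha> (Suc m) + real m / real (Suc m) * (K * real m powr (- \<alpha>))"
    unfolding copson_eq
    using copson_of_cesaro_bound(2)[of \<alpha> x K m, OF assms] by linarith
  also have "\<dots> = K * (power_tail \<alpha> (Suc m) + real m / real (Suc m) * real m powr (- \<alpha>))"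
    by (simp add: algebra_simps)
  finally have "\<bar>copson x (Suc m)\<bar> * real (Suc m) powr \<alpha>
      \<le> K * (power_tail \<alpha> (Suc m) + real m / real (Suc m) * real m powr (- \<alpha>)) * real (Suc m) powr \<alpha>"
    by (rule mult_right_mono) simp
  then show ?thesis by (simp add: extremal_value_def mult_ac)
qed

text \<open>For nonnegative \<open>x\<close> the mean that Abel's formula subtracts is nonnegative and can be dropped.
  This is why the constant loses its summand \<open>1\<close>.\<close>

lemma copson_abs_le_of_nonneg:
  assumes "0 < \<alpha>" and bound: "\<And>k. 1 \<le> k \<Longrightarrow> \<bar>cesaro x k\<bar> \<le> K * real k powr (- \<alpha>)"
    and nonneg: "\<And>k. 1 \<le> k \<Longrightarrow> 0 \<le> x k"
  shows "\<bar>copson x (Suc m)\<bar> * real (Suc m) powr \<alpha>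
    \<le> K * (real (Suc m) powr \<alpha> * power_tail \<alpha> (Suc m))"
proof -
  have sums: "(\<lambda>j. x (Suc m + j) / real (Suc m + j)) sums
      ((\<Sum>j. cesaro x (Suc m + j) / (real (Suc m + j) + 1)) - real m / real (Suc m) * cesaro x m)"
    using assms by (intro copson_of_cesaro_bound(1))
  have le: "\<bar>\<Sum>j. cesaro x (Suc m + j) / (real (Suc m + j) + 1)\<bar> \<le> K * power_tail \<alpha> (Suc m)"
    using assms by (intro copson_of_cesaro_bound(2))
  have "0 \<le> real m / real (Suc m)" by simp
  moreover have "0 \<le> cesaro x m"
    unfolding cesaro_def by (intro mult_nonneg_nonneg sum_nonneg nonneg) auto
  ultimately have "copson x (Suc m) \<le> K * power_tail \<alpha> (Suc m)"
    using abs_le_D1[OF le] mult_nonneg_nonneg[of "real m / real (Suc m)" "cesaro x m"]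
    unfolding copson_def sums_unique[OF sums, symmetric] by linarith
  moreover have "0 \<le> copson x (Suc m)"
    unfolding copson_def using sums
    by (intro suminf_nonneg) (auto simp: sums_iff intro!: divide_nonneg_nonneg nonneg)
  ultimately have "\<bar>copson x (Suc m)\<bar> * real (Suc m) powr \<alpha>
      \<le> K * power_tail \<alpha> (Suc m) * real (Suc m) powr \<alpha>"
    by (intro mult_right_mono) auto
  then show ?thesis by (simp add: mult_ac)
qed

section \<open>Reduction of the inequality to real bounds\<close>

lemma copson_cesaro_ineqI:
  assumes "0 \<le> A"
    and "\<And>K m. 0 \<le> K \<Longrightarrow> (\<And>k. 1 \<le> k \<Longrightarrow> \<bar>cesaro x k\<bar> \<le> K * real k powr (- \<alpha>))
      \<Longrightarrow> \<bar>copson x (Suc m)\<bar> * real (Suc m) powr \<alpha> \<le> A * K"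
  shows "copson_cesaro_ineq \<alpha> (ennreal A) x"
proof (cases "weighted_sup \<alpha> (cesaro x)")
  case (real K)
  have "\<bar>cesaro x k\<bar> \<le> K * real k powr (- \<alpha>)" if "1 \<le> k" for k
  proof -
    have "ennreal (\<bar>cesaro x k\<bar> * real k powr \<alpha>) \<le> ennreal K"
      unfolding real(2)[symmetric] weighted_sup_def using that by (intro SUP_upper) auto
    then have "\<bar>cesaro x k\<bar> * real k powr \<alpha> \<le> K" using real(1) by simp
    then show ?thesis using that by (simp add: powr_minus field_simps)
  qed
  note bound = assms(2)[OF real(1) this]
  have "weighted_sup \<alpha> (copson x) \<le> ennreal (A * K)"
    unfolding weighted_sup_def
  proof (intro SUP_least ennreal_leI)
    fix n :: nat assume "n \<in> {1..}"
    then show "\<bar>copson x n\<bar> * real n powr \<alpha> \<le> A * K" using bound[of "n - 1"] by simp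
  qed
  also have "\<dots> = ennreal A * weighted_sup \<alpha> (cesaro x)"
    using real assms(1) by (simp add: ennreal_mult)
  finally show ?thesis by (simp add: copson_cesaro_ineq_def)
qed (simp add: copson_cesaro_ineq_def)

lemma copson_cesaro_ineq_lower:
  assumes "copson_cesaro_ineq \<alpha> B x"
    and "\<And>k. 1 \<le> k \<Longrightarrow> \<bar>cesaro x k\<bar> * real k powr \<alpha> \<le> 1" and "1 \<le> n"
  shows "ennreal (\<bar>copson x n\<bar> * real n powr \<alpha>) \<le> B"
proof -
  have le: "weighted_sup \<alpha> (cesaro x) \<le> 1"
    unfolding weighted_sup_def using assms(2) by (intro SUP_least) (simp add: ennreal_le_1)
  have "ennreal (\<bar>copson x n\<bar> * real n powr \<alpha>) \<le> weighted_sup \<alpha> (copson x)"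
    unfolding weighted_sup_def using assms(3) by (intro SUP_upper) auto
  also have "\<dots> \<le> B * weighted_sup \<alpha> (cesaro x)"
    using assms(1) le by (auto simp: copson_cesaro_ineq_def top_unique)
  also have "\<dots> \<le> B * 1" by (intro mult_left_mono le) simp
  finally show ?thesis by simp
qed

section \<open>Extremal sequences\<close>

text \<open>The sequence with means \<open>c\<close>. For \<open>k = 1\<close> the truncated \<open>k - 1\<close> is harmless, since \<open>c 0\<close> is
  multiplied by \<open>0\<close>.\<close>

definition of_cesaro :: "(nat \<Rightarrow> real) \<Rightarrow> nat \<Rightarrow> real" where
  "of_cesaro c k = real k * c k - real (k - 1) * c (k - 1)"

lemma cesaro_of_cesaro:
  assumes "1 \<le> n"
  shows "cesaro (of_cesaro c) n = c n"
proof -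
  have "(\<Sum>k = 1..n. of_cesaro c k) = real n * c n"
    by (induction n) (auto simp: of_cesaro_def)
  then show ?thesis using assms by (simp add: cesaro_def)
qed

lemma of_cesaro_extremal:
  assumes "0 < \<alpha>" and c: "\<And>k. 1 \<le> k \<Longrightarrow> \<bar>c k\<bar> \<le> real k powr (- \<alpha>)"
  shows "of_cesaro c \<in> copson_dom"
    and "\<And>k. 1 \<le> k \<Longrightarrow> \<bar>cesaro (of_cesaro c) k\<bar> * real k powr \<alpha> \<le> 1"
    and "copson (of_cesaro c) (Suc m) = (\<Sum>j. c (Suc m + j) / (real (Suc m + j) + 1)) - real m / real (Suc m) * c m"
proof -
  let ?x = "of_cesaro c"
  note ces = cesaro_of_cesaro[of _ c]
  have bound: "\<And>k. 1 \<le> k \<Longrightarrow> \<bar>cesaro ?x k\<bar> \<le> 1 * real k powr (- \<alpha>)"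
    using c by (simp add: ces)
  show "\<bar>cesaro ?x k\<bar> * real k powr \<alpha> \<le> 1" if "1 \<le> k" for k
    using c[OF that] that by (simp add: ces powr_minus field_simps)
  show "?x \<in> copson_dom"
    using copson_of_cesaro_bound(1)[OF assms(1) bound, of 0]
    by (simp add: copson_dom_def sums_iff)
  have "real m / real (Suc m) * cesaro ?x m = real m / real (Suc m) * c m"
    by (cases "m = 0") (auto simp: ces)
  then show "copson ?x (Suc m) = (\<Sum>j. c (Suc m + j) / (real (Suc m + j) + 1)) - real m / real (Suc m) * c m"
    using copson_of_cesaro_bound(1)[OF assms(1) bound, of m]
    by (simp add: copson_def sums_iff ces)
qed

text \<open>Equality in the triangle inequality behind \<open>copson_abs_le\<close>: the means have the largest
  modulus allowed, are positive from \<open>Suc m\<close> on and negative before.\<close>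

lemma extremal_value_le_constant:
  assumes "0 < \<alpha>" and B: "\<forall>x\<in>copson_dom. copson_cesaro_ineq \<alpha> B x"
  shows "ennreal (extremal_value \<alpha> m) \<le> B"
proof -
  define c where "c k = (if k \<le> m then - (real k powr (- \<alpha>)) else real k powr (- \<alpha>))" for k
  define x where "x = of_cesaro c"
  have c: "\<And>k. 1 \<le> k \<Longrightarrow> \<bar>c k\<bar> \<le> real k powr (- \<alpha>)" by (simp add: c_def)
  have copson_x: "copson x (Suc m)
      = (\<Sum>j. c (Suc m + j) / (real (Suc m + j) + 1)) - real m / real (Suc m) * c m"
    unfolding x_def by (intro of_cesaro_extremal(3)[OF assms(1)] c)
  note x = of_cesaro_extremal(1,2)[OF assms(1) c, folded x_def]
  have "copson x (Suc m) = power_tail \<alpha> (Suc m) + real m / real (Suc m) * real m powr (- \<alpha>)"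
    unfolding copson_x power_tail_def tail_term_def by (simp add: c_def)
  moreover have "ennreal (\<bar>copson x (Suc m)\<bar> * real (Suc m) powr \<alpha>) \<le> B"
    using B x by (intro copson_cesaro_ineq_lower) auto
  ultimately show ?thesis
    using power_tail_nonneg[OF assms(1), of "Suc m"]
    by (simp add: extremal_value_def mult_ac)
qed

text \<open>For nonnegative sequences the best choice is to have vanishing means up to \<open>m\<close> and then
  means \<open>k powr (- \<alpha>)\<close>. The partial sums \<open>k powr (1 - \<alpha>)\<close> increase because \<open>\<alpha> \<le> 1\<close>,
  so the sequence is indeed nonnegative.\<close>

lemma scaled_power_tail_le_constant:
  assumes "0 < \<alpha>" "\<alpha> \<le> 1"
    and B: "\<forall>x\<in>{x \<in> copson_dom. \<forall>k\<ge>1. x k \<ge> 0}. copson_cesaro_ineq \<alpha> B x"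
  shows "ennreal (real (Suc m) powr \<alpha> * power_tail \<alpha> (Suc m)) \<le> B"
proof -
  define c where "c k = (if k \<le> m then 0 else real k powr (- \<alpha>))" for k
  define x where "x = of_cesaro c"
  have c: "\<And>k. 1 \<le> k \<Longrightarrow> \<bar>c k\<bar> \<le> real k powr (- \<alpha>)" by (simp add: c_def)
  have copson_x: "copson x (Suc m)
      = (\<Sum>j. c (Suc m + j) / (real (Suc m + j) + 1)) - real m / real (Suc m) * c m"
    unfolding x_def by (intro of_cesaro_extremal(3)[OF assms(1)] c)
  note x = of_cesaro_extremal(1,2)[OF assms(1) c, folded x_def]
  \<comment> \<open>the partial sums of \<open>x\<close> beyond \<open>m\<close>\<close>
  have powr1: "real k * real k powr (- \<alpha>) = real k powr (1 - \<alpha>)" for k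
    by (cases "k = 0") (auto simp: powr_diff powr_minus field_simps)
  have "0 \<le> x k" if "1 \<le> k" for k
  proof -
    have "real (k - 1) powr (1 - \<alpha>) \<le> real k powr (1 - \<alpha>)"
      using assms by (intro powr_mono2) auto
    then show ?thesis
      unfolding x_def of_cesaro_def c_def using powr1[of k] powr1[of "k - 1"] by auto
  qed
  moreover have "copson x (Suc m) = power_tail \<alpha> (Suc m)"
    unfolding copson_x by (simp add: c_def power_tail_def tail_term_def)
  ultimately show ?thesis
    using copson_cesaro_ineq_lower[of \<alpha> B x "Suc m"] B x power_tail_nonneg[OF assms(1), of "Suc m"]
    by (simp add: mult.commute)
qed

text \<open>The indicator of \<open>{1..N}\<close> has means at most \<open>1\<close>, and the weight is at most \<open>1\<close> when
  \<open>\<alpha> \<le> 0\<close>, while its Copson sum at \<open>1\<close> is the \<open>N\<close>-th harmonic number.\<close>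

lemma no_finite_constant:
  assumes "\<alpha> \<le> 0"
    and B: "\<forall>x\<in>{x \<in> copson_dom. \<forall>k\<ge>1. x k \<ge> 0}. copson_cesaro_ineq \<alpha> B x"
  shows "B = \<infinity>"
proof -
  have "ennreal (harm N) \<le> B" for N :: nat
  proof -
    define x :: "nat \<Rightarrow> real" where "x k = (if k \<le> N then 1 else 0)" for k
    have fin: "(\<lambda>k. x (Suc k) / real (Suc k)) sums (\<Sum>k<N. x (Suc k) / real (Suc k))"
      by (rule sums_finite) (auto simp: x_def)
    have "\<bar>cesaro x k\<bar> * real k powr \<alpha> \<le> 1" if "1 \<le> k" for k
    proof -
      have "0 \<le> (\<Sum>i = 1..k. x i)" "(\<Sum>i = 1..k. x i) \<le> real k"
        using sum_bounded_above[of "{1..k}" x 1] by (auto simp: x_def intro!: sum_nonneg)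
      then have "\<bar>cesaro x k\<bar> \<le> 1" using that by (simp add: cesaro_def)
      moreover have "real k powr \<alpha> \<le> 1"
        using that assms powr_mono[of \<alpha> 0 "real k"] by simp
      ultimately show ?thesis using mult_mono[of "\<bar>cesaro x k\<bar>" 1 "real k powr \<alpha>" 1] by simp
    qed
    moreover have "copson x 1 = harm N"
      using fin unfolding copson_def harm_altdef by (simp add: sums_iff x_def inverse_eq_divide)
    moreover have "x \<in> {x \<in> copson_dom. \<forall>k\<ge>1. x k \<ge> 0}"
      using fin by (auto simp: copson_dom_def sums_iff x_def)
    ultimately show ?thesis
      using copson_cesaro_ineq_lower[of \<alpha> B x 1] B by (simp add: harm_nonneg)
  qed
  moreover have "\<exists>N. r < harm N" for r :: real
    using harm_at_top unfolding filterlim_at_top_dense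
    by (auto simp: eventually_sequentially)
  ultimately show ?thesis
    by (cases B) (auto simp: harm_nonneg not_le[symmetric])
qed

section \<open>The best constants\<close>

text \<open>Decay of the means faster than \<open>1 / n\<close> forces the partial sums to tend to \<open>0\<close>, but partial
  sums of a nonnegative sequence increase. So for \<open>\<alpha> > 1\<close> only the zero sequence has a
  finite right-hand side.\<close>

lemma nonneg_eq_zero_of_cesaro_decay:
  assumes "1 < \<alpha>" and bound: "\<And>k. 1 \<le> k \<Longrightarrow> \<bar>cesaro x k\<bar> \<le> K * real k powr (- \<alpha>)"
    and nonneg: "\<And>k. 1 \<le> k \<Longrightarrow> 0 \<le> x k" and "1 \<le> k"
  shows "x k = 0"
proof -
  have "(\<lambda>n. K * real n powr (1 - \<alpha>)) \<longlonglongrightarrow> K * 0"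
    using assms by (intro tendsto_mult tendsto_const tendsto_neg_powr filterlim_real_sequentially) auto
  moreover have "x k \<le> K * real n powr (1 - \<alpha>)" if "k \<le> n" for n
  proof -
    have "x k \<le> (\<Sum>i = 1..n. x i)"
      using that assms(4) nonneg by (intro member_le_sum) auto
    also have "\<dots> = real n * cesaro x n" by (simp only: cesaro_mult)
    also have "\<dots> \<le> real n * (K * real n powr (- \<alpha>))"
      using bound[of n] that assms(4) by (intro mult_left_mono) auto
    also have "\<dots> = K * real n powr (1 - \<alpha>)"
      using that assms(4) by (simp add: powr_diff powr_minus field_simps)
    finally show ?thesis .
  qed
  ultimately have "x k \<le> 0"
    by (intro LIMSEQ_le_const[of "\<lambda>n. K * real n powr (1 - \<alpha>)"]) auto
  then show ?thesis using nonneg[OF assms(4)] by simp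
qed

text \<open>Because \<open>\<infinity> * 0 = 0\<close>, this needs that a sequence with vanishing means vanishes itself.\<close>

lemma copson_cesaro_ineq_infinity: "copson_cesaro_ineq \<alpha> \<infinity> x"
proof (cases "weighted_sup \<alpha> (cesaro x) = 0")
  case True
  have ces: "cesaro x k = 0" if "1 \<le> k" for k
  proof -
    have "ennreal (\<bar>cesaro x k\<bar> * real k powr \<alpha>) \<le> 0"
      unfolding True[symmetric] weighted_sup_def using that by (intro SUP_upper) auto
    then show ?thesis using that by (simp add: mult_le_0_iff)
  qed
  have "x k = 0" if "1 \<le> k" for k
  proof -
    obtain j where j: "k = Suc j" using \<open>1 \<le> k\<close> by (cases k) auto
    have "real k * cesaro x k = real j * cesaro x j + x k"
      unfolding cesaro_mult j by simp
    then show ?thesis using ces[of k] ces[of j] that by (cases "j = 0") auto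
  qed
  then have "weighted_sup \<alpha> (copson x) \<le> 0"
    unfolding weighted_sup_def by (intro SUP_least) (auto simp: copson_def)
  then show ?thesis by (simp add: copson_cesaro_ineq_def)
next
  case False
  then show ?thesis by (simp add: copson_cesaro_ineq_def)
qed

lemma ennreal_le_of_tendsto:
  assumes "f \<longlonglongrightarrow> a" "\<And>m::nat. ennreal (f m) \<le> B"
  shows "ennreal a \<le> B"
  using tendsto_ennrealI[OF assms(1)] by (rule LIMSEQ_le_const2) (use assms(2) in auto)

text \<open>Stated for every class that contains the nonnegative sequences, so that it
  serves both halves of the theorem.\<close>

lemma best_constant_nonpos:
  assumes "\<alpha> \<le> 0" "{x \<in> copson_dom. \<forall>k\<ge>1. x k \<ge> 0} \<subseteq> X"
  shows "best_constant \<alpha> X \<infinity>"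
  unfolding best_constant_def
  using no_finite_constant[OF assms(1)] assms(2) copson_cesaro_ineq_infinity by blast

lemma best_constant_le_1:
  assumes "0 < \<alpha>" "\<alpha> \<le> 1"
  shows "best_constant \<alpha> copson_dom (ennreal (1 + 1 / \<alpha>))"
  unfolding best_constant_def
proof (intro conjI ballI allI impI)
  fix x :: "nat \<Rightarrow> real"
  show "copson_cesaro_ineq \<alpha> (ennreal (1 + 1 / \<alpha>)) x"
  proof (rule copson_cesaro_ineqI)
    fix K :: real and m :: nat
    assume K: "0 \<le> K" "\<And>k. 1 \<le> k \<Longrightarrow> \<bar>cesaro x k\<bar> \<le> K * real k powr (- \<alpha>)"
    have "K * extremal_value \<alpha> m \<le> K * (1 + 1 / \<alpha>)"
      using K(1) extremal_value_bounds(2)[OF assms] by (intro mult_left_mono)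
    with copson_abs_le[OF assms(1) K(2), of m]
    show "\<bar>copson x (Suc m)\<bar> * real (Suc m) powr \<alpha> \<le> (1 + 1 / \<alpha>) * K"
      unfolding mult.commute[of _ K] by (rule order_trans)
  qed (use assms in simp)
next
  fix B assume B: "\<forall>x\<in>copson_dom. copson_cesaro_ineq \<alpha> B x"
  have "(\<lambda>m. real m / real (Suc m) * (1 + 1 / \<alpha>)) \<longlonglongrightarrow> 1 * (1 + 1 / \<alpha>)"
    by (intro tendsto_mult LIMSEQ_n_over_Suc_n tendsto_const)
  then have lim: "(\<lambda>m. real m / real (Suc m) * (1 + 1 / \<alpha>)) \<longlonglongrightarrow> 1 + 1 / \<alpha>"
    by simp
  then show "ennreal (1 + 1 / \<alpha>) \<le> B"
  proof (rule ennreal_le_of_tendsto)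
    show "ennreal (real m / real (Suc m) * (1 + 1 / \<alpha>)) \<le> B" for m
      by (rule order_trans[OF ennreal_leI[OF extremal_value_bounds(1)[OF assms]]
            extremal_value_le_constant[OF assms(1) B]])
  qed
qed

lemma best_constant_gt_1:
  assumes "1 < \<alpha>"
  shows "best_constant \<alpha> copson_dom (ennreal (2 powr \<alpha>) * M \<alpha>)"
proof -
  have a0: "0 < \<alpha>" using assms by simp
  have nonneg: "0 \<le> extremal_value \<alpha> 1"
    using power_tail_nonneg[OF a0] unfolding extremal_value_1[OF a0] by simp
  have A: "ennreal (2 powr \<alpha>) * M \<alpha> = ennreal (extremal_value \<alpha> 1)"
    unfolding M_eq_power_tail[OF a0] extremal_value_1[OF a0]
    using power_tail_nonneg[OF a0, of 1] by (intro ennreal_mult[symmetric]) auto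
  show ?thesis
    unfolding best_constant_def A
  proof (intro conjI ballI allI impI)
    fix x :: "nat \<Rightarrow> real"
    show "copson_cesaro_ineq \<alpha> (ennreal (extremal_value \<alpha> 1)) x"
    proof (rule copson_cesaro_ineqI[OF nonneg])
      fix K :: real and m :: nat
      assume K: "0 \<le> K" "\<And>k. 1 \<le> k \<Longrightarrow> \<bar>cesaro x k\<bar> \<le> K * real k powr (- \<alpha>)"
      have "K * extremal_value \<alpha> m \<le> K * extremal_value \<alpha> 1"
        using K(1) extremal_value_le_1[OF assms] by (intro mult_left_mono)
      with copson_abs_le[OF a0 K(2), of m]
      show "\<bar>copson x (Suc m)\<bar> * real (Suc m) powr \<alpha> \<le> extremal_value \<alpha> 1 * K"
        unfolding mult.commute[of _ K] by (rule order_trans)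
    qed
  qed (use extremal_value_le_constant[OF a0] in blast)
qed

lemma best_constant_nonneg_le_1:
  assumes "0 < \<alpha>" "\<alpha> \<le> 1"
  shows "best_constant \<alpha> {x \<in> copson_dom. \<forall>k\<ge>1. x k \<ge> 0} (ennreal (1 / \<alpha>))"
  unfolding best_constant_def
proof (intro conjI ballI allI impI)
  fix x :: "nat \<Rightarrow> real" assume x: "x \<in> {x \<in> copson_dom. \<forall>k\<ge>1. x k \<ge> 0}"
  show "copson_cesaro_ineq \<alpha> (ennreal (1 / \<alpha>)) x"
  proof (rule copson_cesaro_ineqI)
    fix K :: real and m :: nat
    assume K: "0 \<le> K" "\<And>k. 1 \<le> k \<Longrightarrow> \<bar>cesaro x k\<bar> \<le> K * real k powr (- \<alpha>)"
    have "K * (real (Suc m) powr \<alpha> * power_tail \<alpha> (Suc m)) \<le> K * (1 / \<alpha>)"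
      using K(1) scaled_power_tail_bounds(2)[OF assms, of "Suc m"] by (intro mult_left_mono) auto
    moreover have "\<bar>copson x (Suc m)\<bar> * real (Suc m) powr \<alpha>
        \<le> K * (real (Suc m) powr \<alpha> * power_tail \<alpha> (Suc m))"
      using x by (intro copson_abs_le_of_nonneg assms K(2)) auto
    ultimately show "\<bar>copson x (Suc m)\<bar> * real (Suc m) powr \<alpha> \<le> 1 / \<alpha> * K"
      by (simp only: mult.commute)
  qed (use assms in simp)
next
  fix B assume B: "\<forall>x\<in>{x \<in> copson_dom. \<forall>k\<ge>1. x k \<ge> 0}. copson_cesaro_ineq \<alpha> B x"
  have "(\<lambda>m. real (Suc m) / real (Suc (Suc m)) * (1 / \<alpha>)) \<longlonglongrightarrow> 1 * (1 / \<alpha>)"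
    by (intro tendsto_mult tendsto_const LIMSEQ_Suc[OF LIMSEQ_n_over_Suc_n])
  then have "(\<lambda>m. real (Suc m) / real (Suc (Suc m)) * (1 / \<alpha>)) \<longlonglongrightarrow> 1 / \<alpha>"
    by simp
  then show "ennreal (1 / \<alpha>) \<le> B"
  proof (rule ennreal_le_of_tendsto)
    show "ennreal (real (Suc m) / real (Suc (Suc m)) * (1 / \<alpha>)) \<le> B" for m
      using scaled_power_tail_bounds(1)[OF assms, of "Suc m"]
      by (intro order_trans[OF ennreal_leI scaled_power_tail_le_constant[OF assms B]]) auto
  qed
qed

lemma best_constant_nonneg_gt_1:
  assumes "1 < \<alpha>"
  shows "best_constant \<alpha> {x \<in> copson_dom. \<forall>k\<ge>1. x k \<ge> 0} 0"
proof -
  have "copson_cesaro_ineq \<alpha> (ennreal 0) x" if "\<forall>k\<ge>1. 0 \<le> x k" for x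
  proof (rule copson_cesaro_ineqI)
    fix K :: real and m :: nat
    assume K: "\<And>k. 1 \<le> k \<Longrightarrow> \<bar>cesaro x k\<bar> \<le> K * real k powr (- \<alpha>)"
    have "x k = 0" if "1 \<le> k" for k
      using nonneg_eq_zero_of_cesaro_decay[OF assms K _ that] \<open>\<forall>k\<ge>1. 0 \<le> x k\<close> by blast
    then show "\<bar>copson x (Suc m)\<bar> * real (Suc m) powr \<alpha> \<le> 0 * K"
      by (simp add: copson_def)
  qed simp
  then show ?thesis by (auto simp: best_constant_def)
qed

theorem theorem4p3:
  fixes \<alpha> :: real
  shows "best_constant \<alpha> copson_dom
           (if \<alpha> \<le> 0 then \<infinity>
            else if \<alpha> \<le> 1 then ennreal (1 + 1 / \<alpha>)
            else ennreal (2 powr \<alpha>) * M \<alpha>)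
       \<and> best_constant \<alpha> {x \<in> copson_dom. \<forall>k\<ge>1. x k \<ge> 0}
           (if \<alpha> \<le> 0 then \<infinity>
            else if \<alpha> \<le> 1 then ennreal (1 / \<alpha>)
            else 0)"
  using best_constant_nonpos[of \<alpha>] best_constant_le_1[of \<alpha>] best_constant_gt_1[of \<alpha>]
    best_constant_nonneg_le_1[of \<alpha>] best_constant_nonneg_gt_1[of \<alpha>]
  by auto

end
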